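(* Let $m,n\ge 1$ be integers, let $r\in\mathbb{Z}/n\mathbb{Z}$, and let $\lambda=(\lambda_1\ge\cdots\ge\lambda_m\ge0)$ be a partition with at most $m$ parts. Let $\delta=(m-1,m-2,\ldots,1,0)$. Then $$s_\lambda^{(r)}(\mathbf{x}_1,\ldots,\mathbf{x}_m)=\frac{b_{\lambda+\delta}^{(r)}}{b_\delta^{(r)}}=\frac{b_{\lambda+\delta}^{(r)}}{\prod_{1\le i<j\le m}(\pi_i-\pi_j)}.$$
   Context: Fix integers $m,n\ge 1$. For $i\in\{1,\dots,m\}$ and $j\in\mathbb{Z}/n\mathbb{Z}$ let $x_i^{(j)}$ be an indeterminate, and work in the field $\mathbb{Q}(x_i^{(j)})$ of rational functions in these $mn$ indeterminates. All superscripts in parentheses are read modulo $n$. Write $\mathbf{x}_i=(x_i^{(1)},\dots,x_i^{(n)})$ and $\pi_i=x_i^{(1)}x_i^{(2)}\cdots x_i^{(n)}$. **Loop Schur functions.** Boxes of a Young diagram are indexed by (row, column) $=(i,j)$ with $i,j\ge1$. A semistandard tableau $T$ of shape $\lambda$ is a filling of the Young diagram of $\lambda$ with positive integers that is weakly increasing along rows and strictly increasing down columns. For $r\in\mathbb{Z}/n\mathbb{Z}$ define $$s_\lambda^{(r)}(\mathbf{x}_1,\dots,\mathbf{x}_m)=\sum_T\ \prod_{(i,j)\in\lambda} x_{T(i,j)}^{(r+i-j)},$$ the sum being over semistandard tableaux $T$ of shape $\lambda$ with entries in $\{1,\dots,m\}$; $s_\emptyset^{(r)}=1$. **The polynomials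 $\sigma_k^{(r)}$.** For $k\ge1$, $r\in\mathbb{Z}/n\mathbb{Z}$ and $1\le a\le b\le m$, let $$\sigma_k^{(r)}(\mathbf{x}_a,\ldots,\mathbf{x}_b)=\sum x_{i_1}^{(r)}x_{i_2}^{(r-1)}\cdots x_{i_k}^{(r-k+1)},$$ where the sum is over weakly increasing sequences $a\le i_1\le\cdots\le i_k\le b$ such that each of the numbers $a+1,a+2,\ldots,b$ appears in the sequence at most $n-1$ times (there is no restriction on the number of times $a$ appears). Set $\sigma_0^{(r)}=1$. **The determinants $b_\alpha^{(r)}$.** For a sequence $\alpha=(\alpha_1,\dots,\alpha_m)$ of non-negative integers, let $B_\alpha^{(r)}$ be the $m\times m$ matrix with entries $$(B_\alpha^{(r)})_{ij}=x_j^{(r+j-1)}x_j^{(r+j-2)}\cdots x_j^{(r+j-\alpha_i)}\;\sigma_{(n-1)(m-j)}^{(r+j-\alpha_i-1)}(\mathbf{x}_j,\ldots,\mathbf{x}_m)$$ (the product of $x_j$'s has $\alpha_i$ factors and equals $1$ if $\alpha_i=0$), and let $b_\alpha^{(r)}=\det(B_\alpha^{(r)})$. Addition $\lambda+\delta$ is componentwise. *)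

theory Defs
  imports
    "HOL-Library.Poly_Mapping"
    "HOL-Library.Product_Lexorder"
    "HOL-Library.FuncSet"
    "HOL-Computational_Algebra.Polynomial_Factorial"
    "Jordan_Normal_Form.Determinant"
begin

text \<open>
  The field of rational functions over the rationals in indeterminates indexed by
  \<^typ>\<open>nat \<times> int\<close>. For given \<open>m\<close> and \<open>n\<close> only the \<open>m n\<close> indeterminates with index in
  \<open>{1..m} \<times> {0..<n}\<close> are used, so all identities live in the subfield generated by them.
  The lexicographic order on indices only serves to make the polynomial ring an instance of
  \<^class>\<open>idom\<close>.
\<close>
type_synonym ratfun = "((nat \<times> int \<Rightarrow>\<^sub>0 nat) \<Rightarrow>\<^sub>0 rat) fract"

text \<open>
  Superscripts in \<open>\<int>/n\<int>\<close> are represented by arbitrary integers, reduced modulo \<open>n\<close> here.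
\<close>
definition x_var :: "nat \<Rightarrow> nat \<Rightarrow> int \<Rightarrow> ratfun" where
  "x_var n i j = to_fract (Poly_Mapping.single (Poly_Mapping.single (i, j mod int n) 1) 1)"

definition x_pi :: "nat \<Rightarrow> nat \<Rightarrow> ratfun" where
  "x_pi n i = (\<Prod>j = 1..n. x_var n i (int j))"

text \<open>
  Partitions and other sequences of length \<open>m\<close> are lists: the \<open>i\<close>-th term, counted from 1,
  is \<open>xs ! (i - 1)\<close>.
\<close>
definition young_diagram :: "nat list \<Rightarrow> (nat \<times> nat) set" where
  "young_diagram lam = {(i, j). 1 \<le> i \<and> i \<le> length lam \<and> 1 \<le> j \<and> j \<le> lam ! (i - 1)}"

definition ssyt :: "nat \<Rightarrow> nat list \<Rightarrow> (nat \<times> nat \<Rightarrow> nat) set" where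
  "ssyt m lam = {T \<in> young_diagram lam \<rightarrow>\<^sub>E {1..m}.
     (\<forall>i j j'. (i, j) \<in> young_diagram lam \<and> (i, j') \<in> young_diagram lam \<and> j < j'
        \<longrightarrow> T (i, j) \<le> T (i, j')) \<and>
     (\<forall>i i' j. (i, j) \<in> young_diagram lam \<and> (i', j) \<in> young_diagram lam \<and> i < i'
        \<longrightarrow> T (i, j) < T (i', j))}"

definition loop_schur :: "nat \<Rightarrow> nat \<Rightarrow> int \<Rightarrow> nat list \<Rightarrow> ratfun" where
  "loop_schur n m r lam =
     (\<Sum>T\<in>ssyt m lam. \<Prod>(i, j)\<in>young_diagram lam. x_var n (T (i, j)) (r + int i - int j))"

definition sigma_seqs :: "nat \<Rightarrow> nat \<Rightarrow> nat \<Rightarrow> nat \<Rightarrow> nat list set" where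
  "sigma_seqs n k a b = {s. length s = k \<and> sorted s \<and> set s \<subseteq> {a..b} \<and>
     (\<forall>c\<in>{a + 1..b}. count_list s c \<le> n - 1)}"

definition sigma :: "nat \<Rightarrow> nat \<Rightarrow> int \<Rightarrow> nat \<Rightarrow> nat \<Rightarrow> ratfun" where
  "sigma n k r a b =
     (\<Sum>s\<in>sigma_seqs n k a b. \<Prod>l = 1..k. x_var n (s ! (l - 1)) (r - int l + 1))"

definition B_entry :: "nat \<Rightarrow> nat \<Rightarrow> int \<Rightarrow> nat list \<Rightarrow> nat \<Rightarrow> nat \<Rightarrow> ratfun" where
  "B_entry n m r \<alpha> i j =
     (\<Prod>t = 1..\<alpha> ! (i - 1). x_var n j (r + int j - int t)) *
     sigma n ((n - 1) * (m - j)) (r + int j - int (\<alpha> ! (i - 1)) - 1) j m"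

text \<open>\<^const>\<open>mat\<close> counts rows and columns from 0, \<^const>\<open>B_entry\<close> from 1.\<close>
definition B_mat :: "nat \<Rightarrow> nat \<Rightarrow> int \<Rightarrow> nat list \<Rightarrow> ratfun mat" where
  "B_mat n m r \<alpha> = mat m m (\<lambda>(i, j). B_entry n m r \<alpha> (i + 1) (j + 1))"

definition b_det :: "nat \<Rightarrow> nat \<Rightarrow> int \<Rightarrow> nat list \<Rightarrow> ratfun" where
  "b_det n m r \<alpha> = det (B_mat n m r \<alpha>)"

definition staircase :: "nat \<Rightarrow> nat list" where
  "staircase m = map (\<lambda>i. m - i) [1..<m + 1]"

end

theory Submission
  imports Defs
begin

text \<open>
  Both sides satisfy the same branching rule in the number \<open>m\<close> of alphabets. As a function of the
  exponent \<open>a\<close>, the entry \<open>f\<^sub>m(a)\<close> in column \<open>j\<close> of the matrix satisfies the first-order recurrence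
  \<open>f\<^sub>m(a + 1) = x\<^sub>m\<^bsup>(r+m-a-1)\<^esup> f\<^sub>m(a) + (\<pi>\<^sub>j - \<pi>\<^sub>m) f\<^sub>m\<^sub>-\<^sub>1(a)\<close>, without the last term if \<open>j = m\<close>.
  Subtracting from each row the suitable multiple of the next one therefore clears the last
  column, and by multilinearity \<open>b\<^bsub>\<lambda>+\<delta>\<^esub>\<close> becomes \<open>\<Prod>\<^sub>j (\<pi>\<^sub>j - \<pi>\<^sub>m)\<close> times a weighted sum of the
  determinants for \<open>m - 1\<close> alphabets over all \<open>\<mu>\<close> interlacing \<open>\<lambda>\<close>. The weights are those of the
  horizontal strips \<open>\<lambda>/\<mu>\<close> that carry the letter \<open>m\<close> in semistandard tableaux.
\<close>

section \<open>The products \<open>\<pi>\<^sub>i\<close> and the polynomials \<open>\<sigma>\<^sub>k\<close>\<close>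

lemma x_var_periodic: "x_var n i (z + int n) = x_var n i z"
  by (simp add: x_var_def)

lemma x_var_add_mult: "x_var n i (z + int n * w) = x_var n i z"
  by (simp add: x_var_def)

text \<open>Moving the window of superscripts by one exchanges the factor at \<open>e\<close> for
  the factor at \<open>e + n\<close>, which is equal by periodicity. Hence the start of the window
  is immaterial, and the window that starts at 1 is \<open>x_pi\<close>.\<close>

lemma prod_consecutive_x_var:
  assumes "n \<ge> 1"
  shows "(\<Prod>q<n. x_var n i (e + int q)) = x_pi n i"
proof -
  obtain n' where n': "n = Suc n'" using assms by (cases n) auto
  have step: "(\<Prod>q<n. x_var n i (e + 1 + int q)) = (\<Prod>q<n. x_var n i (e + int q))" for e
  proof -
    have "(\<Prod>q<n. x_var n i (e + int q))
        = x_var n i e * (\<Prod>q<n'. x_var n i (e + 1 + int q))"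
      unfolding n' prod.lessThan_Suc_shift by (simp add: algebra_simps)
    moreover have "(\<Prod>q<n. x_var n i (e + 1 + int q))
        = (\<Prod>q<n'. x_var n i (e + 1 + int q)) * x_var n i (e + int n)"
      unfolding n' prod.lessThan_Suc by (simp add: algebra_simps)
    ultimately show ?thesis by (simp add: x_var_periodic mult.commute)
  qed
  have "(\<Prod>q<n. x_var n i (e + int q)) = (\<Prod>q<n. x_var n i (1 + int q))"
  proof (induction e rule: int_induct[where k = 1])
    case base show ?case by simp
  next
    case (step1 e) then show ?case using step[of e] by simp
  next
    case (step2 e) then show ?case using step[of "e - 1"] by simp
  qed
  also have "\<dots> = x_pi n i"
    unfolding x_pi_def
    by (rule prod.reindex_bij_witness[of _ "\<lambda>q. q - 1" Suc]) auto
  finally show ?thesis .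
qed

lemma to_fract_prod: "to_fract (\<Prod>a\<in>A. f a) = (\<Prod>a\<in>A. to_fract (f a))"
  by (induction A rule: infinite_finite_induct) simp_all

text \<open>Each \<open>x_pi n k\<close> is a single monomial in the indeterminates of alphabet
  \<open>k\<close> alone, so different alphabets give different monomials. This makes the
  denominator of the bialternant formula nonzero.\<close>

lemma x_pi_inject:
  assumes "n \<ge> 1" "x_pi n i = x_pi n i'"
  shows "i = i'"
proof (rule ccontr)
  assume ne: "i \<noteq> i'"
  \<comment> \<open>The exponent vector of \<open>x_pi n k\<close>. Its value at
    \<open>(i, 1 mod int n)\<close> is positive for \<open>k = i\<close> and zero for every other
    \<open>k\<close>.\<close>
  define mon where "mon k = (\<Sum>j = 1..n. Poly_Mapping.single (k, int j mod int n) (1::nat))" for k :: nat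
  have "(\<Prod>j\<in>A. Poly_Mapping.single (Poly_Mapping.single (k, int j mod int n) (1::nat)) (1::rat))
      = Poly_Mapping.single (\<Sum>j\<in>A. Poly_Mapping.single (k, int j mod int n) 1) 1"
    if "finite A" for A :: "nat set" and k :: nat
    using that by (induction A) (simp_all add: mult_single flip: single_one)
  then have pi: "x_pi n k = to_fract (Poly_Mapping.single (mon k) (1::rat))" for k
    unfolding x_pi_def x_var_def mon_def by (simp add: to_fract_prod[symmetric])
  have "Poly_Mapping.single (mon i) (1::rat) = Poly_Mapping.single (mon i') 1"
    using assms(2) unfolding pi by simp
  then have "Poly_Mapping.keys (Poly_Mapping.single (mon i) (1::rat))
      = Poly_Mapping.keys (Poly_Mapping.single (mon i') (1::rat))" by simp
  then have "mon i = mon i'" by simp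
  then have "Poly_Mapping.lookup (mon i) (i, 1 mod int n)
      = Poly_Mapping.lookup (mon i') (i, 1 mod int n)" by simp
  moreover have "Poly_Mapping.lookup (mon i') (i, 1 mod int n) = 0"
    unfolding mon_def lookup_sum using ne by (simp add: lookup_single when_def)
  moreover have "Poly_Mapping.lookup (mon i) (i, 1 mod int n) > 0"
    unfolding mon_def lookup_sum
    by (rule sum_pos2[of _ 1]) (use assms(1) in \<open>auto simp: lookup_single\<close>)
  ultimately show False by simp
qed

section \<open>Recurrences of \<open>sigma\<close> in the length and in the largest letter\<close>

lemma sorted_eq_append_replicate_top:
  assumes "sorted xs" "set xs \<subseteq> {..Suc k}"
  shows "filter (\<lambda>x. x \<le> k) xs @ replicate (count_list xs (Suc k)) (Suc k) = xs"
  using assms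
proof (induction xs)
  case (Cons x xs)
  show ?case
  proof (cases "x \<le> k")
    case True
    then show ?thesis using Cons by simp
  next
    case False
    then have x: "x = Suc k" using Cons.prems by auto
    have "filter (\<lambda>x. x \<le> k) xs = []" using Cons.prems x by (auto simp: filter_empty_conv)
    then show ?thesis using Cons x by simp
  qed
qed simp

lemma finite_sigma_seqs: "finite (sigma_seqs n K a b)"
proof (rule finite_subset)
  show "sigma_seqs n K a b \<subseteq> {xs. set xs \<subseteq> {a..b} \<and> length xs = K}"
    unfolding sigma_seqs_def by auto
qed (simp add: finite_lists_length_eq)

lemma sigma_altdef:
  "sigma n K r a b = (\<Sum>s\<in>sigma_seqs n K a b. \<Prod>p<K. x_var n (s ! p) (r - int p))"
proof -
  have "(\<Prod>l = 1..K. x_var n (s ! (l - 1)) (r - int l + 1)) = (\<Prod>p<K. x_var n (s ! p) (r - int p))"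
    for s
    by (rule prod.reindex_bij_witness[of _ Suc "\<lambda>l. l - 1"])
      (auto simp: of_nat_diff algebra_simps)
  then show ?thesis unfolding sigma_def by simp
qed

text \<open>The only letter is the unrestricted one, so the constant sequence is admissible at every
  length.\<close>

lemma sigma_single: "sigma n K r a a = (\<Prod>p<K. x_var n a (r - int p))"
proof -
  have "sigma_seqs n K a a = {replicate K a}"
  proof
    show "sigma_seqs n K a a \<subseteq> {replicate K a}"
      unfolding sigma_seqs_def by (auto simp: subset_iff intro!: replicate_eqI)
  qed (auto simp: sigma_seqs_def)
  then show ?thesis unfolding sigma_altdef by simp
qed

text \<open>Sequences are sorted by the number \<open>c\<close> of copies of the largest letter,
  which form the final block. As \<open>a \<le> b\<close>, this letter is a restricted one, so
  \<open>c\<close> stops at \<open>n - 1\<close>; and \<open>n - 1 \<le> K\<close> makes every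
  \<open>K - c\<close> a true difference.\<close>

lemma sigma_split_top:
  assumes "a \<le> b" "n - 1 \<le> K"
  shows "sigma n K r a (Suc b)
    = (\<Sum>c\<in>{..n - 1}. sigma n (K - c) r a b * (\<Prod>q<c. x_var n (Suc b) (r - int K + 1 + int q)))"
proof -
  have weight: "(\<Prod>p<K. x_var n ((s @ replicate c (Suc b)) ! p) (r - int p))
      = (\<Prod>p<K - c. x_var n (s ! p) (r - int p))
        * (\<Prod>q<c. x_var n (Suc b) (r - int K + 1 + int q))"
    if "c \<le> n - 1" "length s = K - c" for c s
  proof -
    have cK: "c \<le> K" using that assms by simp
    have "{..<K} = {..<K - c} \<union> {K - c..<K}" by auto
    then have "(\<Prod>p<K. x_var n ((s @ replicate c (Suc b)) ! p) (r - int p))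
      = (\<Prod>p<K - c. x_var n ((s @ replicate c (Suc b)) ! p) (r - int p))
        * (\<Prod>p\<in>{K - c..<K}. x_var n ((s @ replicate c (Suc b)) ! p) (r - int p))"
      by (metis (no_types, lifting) finite_atLeastLessThan finite_lessThan
          ivl_disj_int_one(2) prod.union_disjoint)
    also have "(\<Prod>p<K - c. x_var n ((s @ replicate c (Suc b)) ! p) (r - int p))
        = (\<Prod>p<K - c. x_var n (s ! p) (r - int p))"
      by (rule prod.cong) (auto simp: nth_append that)
    \<comment> \<open>The block is read from its end, \<open>p = K - 1 - q\<close>, so that its
      superscripts start at \<open>r - K + 1\<close> whatever \<open>c\<close> is.\<close>
    also have "(\<Prod>p\<in>{K - c..<K}. x_var n ((s @ replicate c (Suc b)) ! p) (r - int p))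
        = (\<Prod>q<c. x_var n (Suc b) (r - int K + 1 + int q))"
      by (rule prod.reindex_bij_witness[of _ "\<lambda>q. K - 1 - q" "\<lambda>p. K - 1 - p"])
        (use cK in \<open>auto simp: nth_append that of_nat_diff algebra_simps\<close>)
    finally show ?thesis .
  qed
  have "(\<Sum>c\<in>{..n - 1}. sigma n (K - c) r a b * (\<Prod>q<c. x_var n (Suc b) (r - int K + 1 + int q)))
    = (\<Sum>c\<in>{..n - 1}. \<Sum>s\<in>sigma_seqs n (K - c) a b.
        (\<Prod>p<K. x_var n ((s @ replicate c (Suc b)) ! p) (r - int p)))"
    unfolding sigma_altdef sum_distrib_right
    by (intro sum.cong refl weight[symmetric]) (auto simp: sigma_seqs_def)
  also have "\<dots> = (\<Sum>(c, s)\<in>(SIGMA c:{..n - 1}. sigma_seqs n (K - c) a b).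
        (\<Prod>p<K. x_var n ((s @ replicate c (Suc b)) ! p) (r - int p)))"
    by (rule sum.Sigma) (auto simp: finite_sigma_seqs)
  also have "\<dots> = (\<Sum>s\<in>sigma_seqs n K a (Suc b). \<Prod>p<K. x_var n (s ! p) (r - int p))"
  proof (rule sum.reindex_bij_witness[where j = "\<lambda>(c, s). s @ replicate c (Suc b)"
        and i = "\<lambda>s. (count_list s (Suc b), filter (\<lambda>x. x \<le> b) s)"], goal_cases)
    case (1 cs)
    then obtain c s where cs: "cs = (c, s)" "s \<in> sigma_seqs n (K - c) a b" by auto
    have sub: "set s \<subseteq> {a..b}" using cs by (auto simp: sigma_seqs_def)
    then have "Suc b \<notin> set s" by auto
    then have "count_list s (Suc b) = 0" by (simp add: count_list_0_iff)
    moreover have "count_list (replicate c (Suc b)) (Suc b) = c" by (induction c) auto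
    moreover have "filter (\<lambda>x. x \<le> b) s = s" using sub by (intro filter_True) auto
    ultimately show ?case by (simp add: cs)
  next
    case (2 cs)
    then obtain c s where cs: "cs = (c, s)" "s \<in> sigma_seqs n (K - c) a b" "c \<le> n - 1" by auto
    have sub: "set s \<subseteq> {a..b}" using cs by (auto simp: sigma_seqs_def)
    then have "Suc b \<notin> set s" by auto
    then have c0: "count_list s (Suc b) = 0" by (simp add: count_list_0_iff)
    have c1: "count_list (replicate c (Suc b)) d = (if d = Suc b then c else 0)" for d
      by (induction c) auto
    have "count_list (s @ replicate c (Suc b)) d \<le> n - 1" if "d \<in> {a + 1..Suc b}" for d
      using that cs c0 c1 by (cases "d = Suc b") (auto simp: sigma_seqs_def)
    moreover have "sorted (s @ replicate c (Suc b))"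
      using cs sub by (fastforce simp: sigma_seqs_def sorted_append)
    ultimately show ?case
      using cs assms sub by (auto simp: sigma_seqs_def)
  next
    case (3 s)
    then have "sorted s" "set s \<subseteq> {..Suc b}" by (auto simp: sigma_seqs_def)
    then show ?case
      using sorted_eq_append_replicate_top[of s b] by simp
  next
    case (4 s)
    then have s: "length s = K" "sorted s" "set s \<subseteq> {a..Suc b}"
       "\<And>c. c \<in> {a + 1..Suc b} \<Longrightarrow> count_list s c \<le> n - 1"
      by (auto simp: sigma_seqs_def)
    have "set s \<subseteq> {..Suc b}" using s by auto
    from sorted_eq_append_replicate_top[OF s(2) this]
    have "length s = length (filter (\<lambda>x. x \<le> b) s) + count_list s (Suc b)"
      by (metis length_append length_replicate)
    then have len: "length (filter (\<lambda>x. x \<le> b) s) = K - count_list s (Suc b)"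
      using s(1) by simp
    have cnt: "count_list (filter (\<lambda>x. x \<le> b) s) c \<le> count_list s c" for c
      by (induction s) auto
    have "count_list (filter (\<lambda>x. x \<le> b) s) c \<le> n - 1" if "c \<in> {a + 1..b}" for c
      using s(4)[of c] cnt[of c] that by auto
    then show ?case
      using s assms len by (auto simp: sigma_seqs_def sorted_filter[of "\<lambda>x. x", simplified])
  next
    case (5 cs)
    then show ?case by auto
  qed
  finally show ?thesis unfolding sigma_altdef by simp
qed

text \<open>So many letters are forced to include the unrestricted letter \<open>a\<close>.\<close>
lemma sigma_Suc:
  assumes "a \<le> b" "(n - 1) * (b - a) \<le> K"
  shows "sigma n (Suc K) r a b = x_var n a r * sigma n K (r - 1) a b"
  using assms
proof (induction b arbitrary: K rule: dec_induct)
  case base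
  show ?case unfolding sigma_single prod.lessThan_Suc_shift by (simp add: algebra_simps)
next
  case (step b)
  \<comment> \<open>Even after removal of \<open>n - 1\<close> copies of \<open>Suc b\<close> the
    remaining sequence is long enough for the induction hypothesis.\<close>
  have bound: "(n - 1) * (b - a) + (n - 1) \<le> K"
    using step by (simp add: Suc_diff_le)
  \<comment> \<open>Lowering both the length and the superscript by one leaves the superscripts at
    the end of the sequence unchanged. The final block therefore has the same weight on both
    sides.\<close>
  have "sigma n (Suc K) r a (Suc b)
    = (\<Sum>c\<in>{..n - 1}. sigma n (Suc (K - c)) r a b
        * (\<Prod>q<c. x_var n (Suc b) (r - 1 - int K + 1 + int q)))"
    by (subst sigma_split_top)
      (use step bound in \<open>auto intro!: sum.cong simp: Suc_diff_le algebra_simps\<close>)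
  also have "\<dots> = (\<Sum>c\<in>{..n - 1}. x_var n a r * (sigma n (K - c) (r - 1) a b
        * (\<Prod>q<c. x_var n (Suc b) (r - 1 - int K + 1 + int q))))"
  proof (intro sum.cong refl, goal_cases)
    case (1 c)
    have "sigma n (Suc (K - c)) r a b = x_var n a r * sigma n (K - c) (r - 1) a b"
      by (rule step.IH) (use 1 bound in auto)
    then show ?case by (simp add: mult.assoc)
  qed
  also have "\<dots> = x_var n a r * sigma n K (r - 1) a (Suc b)"
    by (subst sigma_split_top) (use step bound in \<open>auto simp: sum_distrib_left\<close>)
  finally show ?case .
qed

text \<open>Peeling off \<open>n\<close> initial letters \<open>a\<close> with
  \<open>sigma_Suc\<close> collects one full period of superscripts, that is
  \<open>x_pi n a\<close>, and shifts the remaining superscript by \<open>n\<close>, which changes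
  nothing.\<close>

lemma sigma_add_n:
  assumes "n \<ge> 1" "a \<le> b" "(n - 1) * (b - a) \<le> K"
  shows "sigma n (K + n) r a b = x_pi n a * sigma n K r a b"
proof -
  have "sigma n (K + p) s a b = (\<Prod>q<p. x_var n a (s - int p + 1 + int q)) * sigma n K (s - int p) a b"
    for p s
  proof (induction p arbitrary: s)
    case (Suc p)
    have "sigma n (K + Suc p) s a b = x_var n a s * sigma n (K + p) (s - 1) a b"
      using sigma_Suc[of a b n "K + p"] assms by simp
    then show ?case unfolding Suc prod.lessThan_Suc by (simp add: algebra_simps)
  qed simp
  from this[of n r] have "sigma n (K + n) r a b = x_pi n a * sigma n K (r - int n) a b"
    using prod_consecutive_x_var[OF assms(1)] by simp
  also have "sigma n K (r - int n) a b = sigma n K r a b"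
  proof -
    have "x_var n i (r - int n - int p) = x_var n i (r - int p)" for i p
      using x_var_periodic[of n i "r - int n - int p"] by (simp add: algebra_simps)
    then show ?thesis unfolding sigma_altdef by simp
  qed
  finally show ?thesis .
qed

text \<open>Both products on the left are sums of the same terms \<open>f c\<close>, where
  \<open>c\<close> counts the factors of the letter \<open>Suc b\<close>: the first runs over
  \<open>c = 0, ..., n - 1\<close>, the second over \<open>c = 1, ..., n\<close>. The difference is
  \<open>f 0 - f n\<close>, and each of these two terms contains a full period, of \<open>a\<close>
  and of \<open>Suc b\<close> respectively.\<close>

lemma sigma_top_recurrence:
  assumes "n \<ge> 1" "a \<le> b" and K: "K = (n - 1) * (Suc b - a)"
  shows "x_var n a s * sigma n K (s - 1) a (Suc b)
      - x_var n (Suc b) (s - int K) * sigma n K s a (Suc b)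
    = (x_pi n a - x_pi n (Suc b)) * sigma n ((n - 1) * (b - a)) s a b"
proof -
  define K' where "K' = (n - 1) * (b - a)"
  obtain n' where n': "n = Suc n'" using assms(1) by (cases n) auto
  \<comment> \<open>This choice of \<open>K\<close> makes the length \<open>Suc K\<close> exceed
    \<open>K'\<close> by exactly one period, which serves both \<open>f 0\<close> and
    \<open>f n\<close>.\<close>
  have KK: "Suc K = K' + n" using assms by (simp add: K'_def Suc_diff_le)
  have nK: "n - 1 \<le> K" using assms by (simp add: Suc_diff_le)
  define Q where "Q c = (\<Prod>q<c. x_var n (Suc b) (s - int K + int q))" for c
  define f where "f c = sigma n (Suc K - c) s a b * Q c" for c
  \<comment> \<open>The factor \<open>x_var n a s\<close> is absorbed as an additional initial
    letter \<open>a\<close>.\<close>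
  have "x_var n a s * sigma n K (s - 1) a (Suc b) = sigma n (Suc K) s a (Suc b)"
    using assms by (subst sigma_Suc) auto
  also have "\<dots> = (\<Sum>c\<in>{..n - 1}. f c)"
    unfolding f_def Q_def
    by (subst sigma_split_top) (use assms(2) nK in \<open>simp_all add: algebra_simps\<close>)
  also have "\<dots> = f 0 + (\<Sum>c<n'. f (Suc c))"
    unfolding n' by (simp add: sum.atMost_shift)
  finally have 1: "x_var n a s * sigma n K (s - 1) a (Suc b) = f 0 + (\<Sum>c<n'. f (Suc c))" .
  have "x_var n (Suc b) (s - int K) * sigma n K s a (Suc b) = (\<Sum>c\<in>{..n - 1}. f (Suc c))"
    unfolding f_def Q_def prod.lessThan_Suc_shift
    by (subst sigma_split_top)
      (use assms(2) nK in \<open>simp_all add: sum_distrib_left algebra_simps\<close>)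
  also have "\<dots> = (\<Sum>c<n'. f (Suc c)) + f n"
    by (simp add: n' lessThan_Suc_atMost[symmetric])
  finally have 2: "x_var n (Suc b) (s - int K) * sigma n K s a (Suc b)
      = (\<Sum>c<n'. f (Suc c)) + f n" .
  have "f 0 = x_pi n a * sigma n K' s a b"
    using sigma_add_n[OF assms(1,2), of K' s] by (simp add: f_def Q_def KK K'_def)
  moreover have "f n = x_pi n (Suc b) * sigma n K' s a b"
    using prod_consecutive_x_var[OF assms(1), of "Suc b" "s - int K"]
    by (simp add: f_def Q_def KK mult.commute)
  ultimately show ?thesis unfolding 1 2 K'_def by (simp add: algebra_simps)
qed

section \<open>Branching of the determinants\<close>

text \<open>Column \<open>j\<close> of the matrix as a function of the exponent \<open>a\<close>.
  The number \<open>k\<close> of alphabets is a parameter, so that entries for \<open>k\<close> and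
  \<open>Suc k\<close> alphabets can be compared.\<close>

definition column_entry :: "nat \<Rightarrow> int \<Rightarrow> nat \<Rightarrow> nat \<Rightarrow> nat \<Rightarrow> ratfun" where
  "column_entry n r k j a =
     (\<Prod>t = 1..a. x_var n j (r + int j - int t)) *
     sigma n ((n - 1) * (k - j)) (r + int j - int a - 1) j k"

lemma B_entry_eq_column_entry: "B_entry n m r \<alpha> i j = column_entry n r m j (\<alpha> ! (i - 1))"
  by (simp add: B_entry_def column_entry_def)

text \<open>This is \<open>sigma_top_recurrence\<close> times the common product of indeterminates
  of alphabet \<open>j\<close>. The coefficient of the first term does not involve \<open>j\<close>,
  which is what lets a single row operation act on all columns.\<close>

lemma column_entry_Suc:
  assumes "n \<ge> 1" "j \<le> k"
  shows "column_entry n r (Suc k) j (Suc a)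
    = x_var n (Suc k) (r + int (Suc k) - int (Suc a)) * column_entry n r (Suc k) j a
      + (x_pi n j - x_pi n (Suc k)) * column_entry n r k j a"
proof -
  define s where "s = r + int j - int (Suc a)"
  define K where "K = (n - 1) * (Suc k - j)"
  define X where "X = (\<Prod>t = 1..a. x_var n j (r + int j - int t))"
  have "int K = (int n - 1) * (int (Suc k) - int j)"
    using assms by (simp add: K_def of_nat_diff)
  \<comment> \<open>The superscript \<open>s - int K\<close> depends on \<open>j\<close>, but only
    through a multiple of \<open>n\<close>, because \<open>K\<close> is \<open>n - 1\<close> times
    \<open>Suc k - j\<close>.\<close>
  then have "r + int (Suc k) - int (Suc a) = (s - int K) + int n * (int (Suc k) - int j)"
    by (simp add: s_def algebra_simps)
  then have x: "x_var n (Suc k) (r + int (Suc k) - int (Suc a)) = x_var n (Suc k) (s - int K)"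
    by (simp only: x_var_add_mult)
  have "column_entry n r (Suc k) j (Suc a) = X * (x_var n j s * sigma n K (s - 1) j (Suc k))"
    by (simp add: column_entry_def X_def s_def K_def algebra_simps)
  moreover have "column_entry n r (Suc k) j a = X * sigma n K s j (Suc k)"
    by (simp add: column_entry_def X_def s_def K_def algebra_simps)
  moreover have "column_entry n r k j a = X * sigma n ((n - 1) * (k - j)) s j k"
    by (simp add: column_entry_def X_def s_def algebra_simps)
  moreover have "x_var n j s * sigma n K (s - 1) j (Suc k)
      = x_var n (Suc k) (s - int K) * sigma n K s j (Suc k)
        + (x_pi n j - x_pi n (Suc k)) * sigma n ((n - 1) * (k - j)) s j k"
    using sigma_top_recurrence[OF assms K_def, of s] by (simp only: diff_eq_eq add.commute)
  ultimately show ?thesis unfolding x by (simp only: distrib_left mult_ac)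
qed

lemma column_entry_last: "column_entry n r k k a = (\<Prod>t = 1..a. x_var n k (r + int k - int t))"
proof -
  have "sigma n 0 s k k = 1" for s by (simp add: sigma_single)
  then show ?thesis by (simp add: column_entry_def)
qed

text \<open>Iteration of \<open>column_entry_Suc\<close>: the correction made at exponent
  \<open>u + e\<close> is multiplied by the coefficients of all later steps. In the application
  \<open>q\<close> and \<open>p\<close> are consecutive parts of the partition and \<open>e\<close>
  is the staircase shift of the lower row, so \<open>u\<close> runs over the interlacing
  interval.\<close>

lemma column_entry_telescope:
  assumes "n \<ge> 1" "j \<le> k" "p \<le> q"
  shows "column_entry n r (Suc k) j (Suc (q + e))
    = (\<Prod>t = p..q. x_var n (Suc k) (r + int k - int (t + e))) * column_entry n r (Suc k) j (p + e)
      + (x_pi n j - x_pi n (Suc k)) *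
        (\<Sum>u = p..q. (\<Prod>t = Suc u..q. x_var n (Suc k) (r + int k - int (t + e)))
            * column_entry n r k j (u + e))"
  using assms(3)
proof (induction q rule: dec_induct)
  case base
  show ?case using column_entry_Suc[OF assms(1,2), of r "p + e"] by (simp add: algebra_simps)
next
  case (step q)
  let ?x = "\<lambda>t. x_var n (Suc k) (r + int k - int (t + e))"
  have "(\<Sum>u = p..Suc q. (\<Prod>t = Suc u..Suc q. ?x t) * column_entry n r k j (u + e))
    = (\<Sum>u = p..q. ?x (Suc q) * ((\<Prod>t = Suc u..q. ?x t) * column_entry n r k j (u + e)))
      + column_entry n r k j (Suc q + e)"
    using step by (simp add: mult_ac add.assoc)
  also have "\<dots> = ?x (Suc q) * (\<Sum>u = p..q. (\<Prod>t = Suc u..q. ?x t) * column_entry n r k j (u + e))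
      + column_entry n r k j (Suc q + e)"
    by (simp add: sum_distrib_left)
  finally have sums: "(\<Sum>u = p..Suc q. (\<Prod>t = Suc u..Suc q. ?x t) * column_entry n r k j (u + e))
    = ?x (Suc q) * (\<Sum>u = p..q. (\<Prod>t = Suc u..q. ?x t) * column_entry n r k j (u + e))
      + column_entry n r k j (Suc q + e)" .
  have prods: "(\<Prod>t = p..Suc q. ?x t) = (\<Prod>t = p..q. ?x t) * ?x (Suc q)"
    using step by (simp add: add.assoc)
  have rec: "column_entry n r (Suc k) j (Suc (Suc q + e))
     = ?x (Suc q) * column_entry n r (Suc k) j (Suc (q + e))
       + (x_pi n j - x_pi n (Suc k)) * column_entry n r k j (Suc q + e)"
    using column_entry_Suc[OF assms(1,2), of r "Suc q + e"] by (simp add: algebra_simps)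
  show ?case unfolding rec step.IH sums prods by (simp only: algebra_simps)
qed

text \<open>In the last column there is no correction term, while the coefficient is the same as in
  the other columns.\<close>

lemma column_entry_last_telescope:
  assumes "p \<le> q"
  shows "column_entry n r (Suc k) (Suc k) (Suc (q + e))
    = (\<Prod>t = p..q. x_var n (Suc k) (r + int k - int (t + e)))
      * column_entry n r (Suc k) (Suc k) (p + e)"
  using assms
proof (induction q rule: dec_induct)
  case base
  show ?case by (simp add: column_entry_last algebra_simps)
next
  case (step q)
  have "column_entry n r (Suc k) (Suc k) (Suc (Suc q + e))
    = x_var n (Suc k) (r + int k - int (Suc q + e)) * column_entry n r (Suc k) (Suc k) (Suc (q + e))"
    by (simp add: column_entry_last algebra_simps)
  then show ?case using step by (simp add: mult_ac add.assoc)
qed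

section \<open>Determinants over a commutative ring\<close>

text \<open>Multilinearity: \<open>d j\<close> is taken out of column \<open>j\<close>, and the
  choice function \<open>g\<close> picks one summand in each row. In the Leibniz formula this is the
  expansion of a product of sums.\<close>

lemma det_row_sums:
  fixes d :: "nat \<Rightarrow> 'a :: comm_ring_1"
  assumes "\<And>i. i < m \<Longrightarrow> finite (C i)"
  shows "det (mat m m (\<lambda>(i, j). d j * (\<Sum>c\<in>C i. w i c * G i c j)))
    = (\<Prod>j = 0..<m. d j) *
      (\<Sum>g\<in>Pi\<^sub>E {0..<m} C. (\<Prod>i = 0..<m. w i (g i)) * det (mat m m (\<lambda>(i, j). G i (g i) j)))"
proof -
  let ?P = "{p. p permutes {0..<m}}" and ?E = "Pi\<^sub>E {0..<m} C"
  have perm_less: "p i < m" if "p permutes {0..<m}" "i < m" for p i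
    using permutes_in_image[OF that(1), of i] that(2) by simp
  have summand: "(\<Prod>i = 0..<m. mat m m (\<lambda>(i, j). d j * (\<Sum>c\<in>C i. w i c * G i c j)) $$ (i, p i))
      = (\<Prod>j = 0..<m. d j) *
        (\<Sum>g\<in>?E. (\<Prod>i = 0..<m. w i (g i)) * (\<Prod>i = 0..<m. G i (g i) (p i)))"
    if p: "p permutes {0..<m}" for p
  proof -
    have "(\<Prod>i = 0..<m. mat m m (\<lambda>(i, j). d j * (\<Sum>c\<in>C i. w i c * G i c j)) $$ (i, p i))
      = (\<Prod>i = 0..<m. d (p i) * (\<Sum>c\<in>C i. w i c * G i c (p i)))"
      using p by (intro prod.cong) (auto simp: perm_less)
    also have "\<dots> = (\<Prod>i = 0..<m. d (p i)) * (\<Prod>i = 0..<m. \<Sum>c\<in>C i. w i c * G i c (p i))"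
      by (rule prod.distrib)
    \<comment> \<open>A permutation meets every column exactly once, so the column factors do not
      depend on it.\<close>
    also have "(\<Prod>i = 0..<m. d (p i)) = (\<Prod>j = 0..<m. d j)"
      using prod.permute[OF p, of d] by (simp add: o_def)
    also have "(\<Prod>i = 0..<m. \<Sum>c\<in>C i. w i c * G i c (p i))
      = (\<Sum>g\<in>?E. \<Prod>i = 0..<m. w i (g i) * G i (g i) (p i))"
      using assms by (intro prod_sum_PiE) auto
    finally show ?thesis by (simp only: prod.distrib)
  qed
  have "det (mat m m (\<lambda>(i, j). d j * (\<Sum>c\<in>C i. w i c * G i c j)))
    = (\<Sum>p\<in>?P. signof p * ((\<Prod>j = 0..<m. d j) *
        (\<Sum>g\<in>?E. (\<Prod>i = 0..<m. w i (g i)) * (\<Prod>i = 0..<m. G i (g i) (p i)))))"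
    by (subst det_def'[of _ m]) (simp, intro sum.cong refl, simp only: mem_Collect_eq summand)
  also have "\<dots> = (\<Prod>j = 0..<m. d j) * (\<Sum>p\<in>?P. \<Sum>g\<in>?E.
       (\<Prod>i = 0..<m. w i (g i)) * (signof p * (\<Prod>i = 0..<m. G i (g i) (p i))))"
    unfolding sum_distrib_left by (intro sum.cong refl) (simp only: mult_ac)
  also have "(\<Sum>p\<in>?P. \<Sum>g\<in>?E.
       (\<Prod>i = 0..<m. w i (g i)) * (signof p * (\<Prod>i = 0..<m. G i (g i) (p i))))
    = (\<Sum>g\<in>?E. \<Sum>p\<in>?P.
       (\<Prod>i = 0..<m. w i (g i)) * (signof p * (\<Prod>i = 0..<m. G i (g i) (p i))))"
    by (rule sum.swap)
  also have "\<dots> = (\<Sum>g\<in>?E. (\<Prod>i = 0..<m. w i (g i)) * det (mat m m (\<lambda>(i, j). G i (g i) j)))"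
  proof (intro sum.cong refl)
    fix g assume "g \<in> ?E"
    have "det (mat m m (\<lambda>(i, j). G i (g i) j))
      = (\<Sum>p\<in>?P. signof p * (\<Prod>i = 0..<m. G i (g i) (p i)))"
      by (subst det_def'[of _ m]) (auto simp: perm_less intro!: sum.cong prod.cong)
    then show "(\<Sum>p\<in>?P. (\<Prod>i = 0..<m. w i (g i)) * (signof p * (\<Prod>i = 0..<m. G i (g i) (p i))))
      = (\<Prod>i = 0..<m. w i (g i)) * det (mat m m (\<lambda>(i, j). G i (g i) j))"
      by (simp add: sum_distrib_left)
  qed
  finally show ?thesis .
qed

text \<open>All subtractions happen at once and use the original next row, so they amount to left
  multiplication by the unitriangular matrix \<open>?U\<close>.\<close>

lemma det_subtract_next_rows:
  fixes A :: "nat \<Rightarrow> nat \<Rightarrow> 'a :: comm_ring_1"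
  shows "det (mat (Suc m) (Suc m) (\<lambda>(i, j). if i < m then A i j - c i * A (Suc i) j else A i j))
    = det (mat (Suc m) (Suc m) (\<lambda>(i, j). A i j))"
proof -
  let ?A = "mat (Suc m) (Suc m) (\<lambda>(i, j). A i j)"
  let ?U = "mat (Suc m) (Suc m) (\<lambda>(i, j). if i = j then 1 else if j = Suc i then - c i else 0)"
  have "?U * ?A = mat (Suc m) (Suc m) (\<lambda>(i, j). if i < m then A i j - c i * A (Suc i) j else A i j)"
  proof (rule eq_matI)
    fix i j
    assume "i < dim_row (mat (Suc m) (Suc m) (\<lambda>(i, j). if i < m then A i j - c i * A (Suc i) j else A i j))"
      and "j < dim_col (mat (Suc m) (Suc m) (\<lambda>(i, j). if i < m then A i j - c i * A (Suc i) j else A i j))"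
    then have ij: "i \<le> m" "j \<le> m" by auto
    have "(?U * ?A) $$ (i, j)
      = (\<Sum>k = 0..<Suc m. (if i = k then 1 else if k = Suc i then - c i else 0) * A k j)"
      using ij by (simp add: scalar_prod_def)
    also have "\<dots> = (\<Sum>k = 0..<Suc m. (if k = i then A k j else 0) + (if k = Suc i then - c i * A k j else 0))"
      by (rule sum.cong) auto
    also have "\<dots> = (if i < m then A i j - c i * A (Suc i) j else A i j)"
      unfolding sum.distrib using ij by simp
    finally show "(?U * ?A) $$ (i, j)
      = mat (Suc m) (Suc m) (\<lambda>(i, j). if i < m then A i j - c i * A (Suc i) j else A i j) $$ (i, j)"
      using ij by simp
  qed auto
  moreover have "det ?U = 1"
    by (subst det_upper_triangular[of _ "Suc m"])
      (auto simp: prod_list_diag_prod intro!: prod.neutral)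
  moreover have "det (?U * ?A) = det ?U * det ?A"
    by (rule det_mult) auto
  ultimately show ?thesis by simp
qed

lemma det_last_column_zero:
  fixes A :: "nat \<Rightarrow> nat \<Rightarrow> 'a :: comm_ring_1"
  assumes "\<And>i. i < m \<Longrightarrow> A i m = 0"
  shows "det (mat (Suc m) (Suc m) (\<lambda>(i, j). A i j)) = A m m * det (mat m m (\<lambda>(i, j). A i j))"
proof -
  let ?A = "mat (Suc m) (Suc m) (\<lambda>(i, j). A i j)"
  have "det ?A = (\<Sum>i<Suc m. ?A $$ (i, m) * cofactor ?A i m)"
    by (rule laplace_expansion_column) auto
  also have "\<dots> = A m m * cofactor ?A m m"
    using assms by simp
  also have "mat_delete ?A m m = mat m m (\<lambda>(i, j). A i j)"
    by (rule eq_matI) (auto simp: mat_delete_def)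
  then have "cofactor ?A m m = det (mat m m (\<lambda>(i, j). A i j))"
    by (simp add: cofactor_def)
  finally show ?thesis .
qed

text \<open>The determinant with the staircase built in. The partition is a function on row indices
  counted from 0, so that the choice functions of \<open>det_row_sums\<close> can be inserted
  directly.\<close>

definition alternant :: "nat \<Rightarrow> nat \<Rightarrow> int \<Rightarrow> (nat \<Rightarrow> nat) \<Rightarrow> ratfun" where
  "alternant n m r l = det (mat m m (\<lambda>(i, j). column_entry n r m (Suc j) (l i + (m - Suc i))))"

lemma alternant_branching:
  assumes n: "n \<ge> 1" and l: "\<And>i. i < m \<Longrightarrow> l (Suc i) \<le> l i"
  shows "alternant n (Suc m) r l
    = (\<Prod>j = 0..<m. x_pi n (Suc j) - x_pi n (Suc m)) *
      (\<Sum>g\<in>(\<Pi>\<^sub>E i\<in>{0..<m}. {l (Suc i)..l i}).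
         (\<Prod>i = 0..<m. \<Prod>t = Suc (g i)..l i. x_var n (Suc m) (r + int (Suc i) - int t)) * alternant n m r g)
      * (\<Prod>t = 1..l m. x_var n (Suc m) (r + int (Suc m) - int t))"
proof -
  \<comment> \<open>The staircase shift of row \<open>i\<close> for \<open>m\<close> alphabets. For
    \<open>Suc m\<close> alphabets row \<open>i\<close> has exponent \<open>Suc (l i + e i)\<close>
    and the next row has \<open>l (Suc i) + e i\<close>, which are the two ends of the
    telescope.\<close>
  define e where "e i = m - Suc i" for i
  define A where "A i j = column_entry n r (Suc m) (Suc j) (l i + (Suc m - Suc i))" for i j
  define c where "c i = (\<Prod>t = l (Suc i)..l i. x_var n (Suc m) (r + int m - int (t + e i)))" for i
  define D where "D i j = (if i < m then A i j - c i * A (Suc i) j else A i j)" for i j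
  define d where "d j = x_pi n (Suc j) - x_pi n (Suc m)" for j
  define w where "w i u = (\<Prod>t = Suc u..l i. x_var n (Suc m) (r + int (Suc i) - int t))" for i u
  have A: "A i j = column_entry n r (Suc m) (Suc j) (Suc (l i + e i))"
    "A (Suc i) j = column_entry n r (Suc m) (Suc j) (l (Suc i) + e i)" if "i < m" for i j
    using that by (simp_all add: A_def e_def Suc_diff_Suc)
  \<comment> \<open>After the shift the superscript is \<open>r\<close> plus row minus column for
    the box in row \<open>Suc i\<close> and column \<open>t\<close>, as in the weight of a
    tableau.\<close>
  have idx: "r + int m - (int t + int (e i)) = r + (1 + int i) - int t" if "i < m" for i t
    using that by (simp add: e_def of_nat_diff)
  \<comment> \<open>The multiple \<open>c i\<close> of the next row cancels the first term of the
    telescope; only the corrections, which live in \<open>m\<close> alphabets, remain.\<close>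
  have D: "D i j = d j * (\<Sum>u = l (Suc i)..l i. w i u * column_entry n r m (Suc j) (u + e i))"
    if "i < m" "j < m" for i j
    using column_entry_telescope[OF n _ l[OF that(1)], of "Suc j" m r "e i"] that
    by (simp add: D_def A c_def d_def w_def idx)
  have D0: "D i m = 0" if "i < m" for i
    using column_entry_last_telescope[OF l[OF that], of n r m "e i"] that
    by (simp add: D_def A c_def)
  have "alternant n (Suc m) r l = det (mat (Suc m) (Suc m) (\<lambda>(i, j). A i j))"
    by (simp add: alternant_def A_def)
  also have "\<dots> = det (mat (Suc m) (Suc m) (\<lambda>(i, j). D i j))"
    unfolding D_def det_subtract_next_rows ..
  also have "\<dots> = D m m * det (mat m m (\<lambda>(i, j). D i j))"
    by (rule det_last_column_zero) (rule D0)
  also have "mat m m (\<lambda>(i, j). D i j) = mat m m (\<lambda>(i, j). d j *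
      (\<Sum>u\<in>{l (Suc i)..l i}. w i u * column_entry n r m (Suc j) (u + e i)))"
    by (rule cong_mat) (auto simp: D)
  also have "det \<dots> = (\<Prod>j = 0..<m. d j) * (\<Sum>g\<in>(\<Pi>\<^sub>E i\<in>{0..<m}. {l (Suc i)..l i}).
      (\<Prod>i = 0..<m. w i (g i)) * alternant n m r g)"
    unfolding alternant_def e_def by (rule det_row_sums) simp
  also have "D m m = (\<Prod>t = 1..l m. x_var n (Suc m) (r + int (Suc m) - int t))"
    by (simp add: D_def A_def column_entry_last)
  finally show ?thesis by (simp add: d_def w_def)
qed

section \<open>Branching of the tableaux\<close>

lemma young_diagram_Sigma: "young_diagram lam = (SIGMA i:{1..length lam}. {1..lam ! (i - 1)})"
  by (auto simp: young_diagram_def)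

lemma ssyt_PiE: "T \<in> ssyt m lam \<Longrightarrow> T \<in> young_diagram lam \<rightarrow>\<^sub>E {1..m}"
  by (simp add: ssyt_def)

lemma finite_ssyt: "finite (ssyt m lam)"
proof (rule finite_subset)
  show "ssyt m lam \<subseteq> (young_diagram lam \<rightarrow>\<^sub>E {1..m})" by (auto simp: ssyt_def)
qed (auto intro!: finite_PiE simp: young_diagram_Sigma)

lemma prod_young_diagram:
  "(\<Prod>(i, j)\<in>young_diagram lam. f i j) = (\<Prod>i = 0..<length lam. \<Prod>j = 1..lam ! i. f (Suc i) j)"
proof -
  have "(\<Prod>(i, j)\<in>young_diagram lam. f i j) = (\<Prod>i = 1..length lam. \<Prod>j = 1..lam ! (i - 1). f i j)"
    unfolding young_diagram_Sigma by (rule prod.Sigma[symmetric]) auto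
  also have "\<dots> = (\<Prod>i = 0..<length lam. \<Prod>j = 1..lam ! i. f (Suc i) j)"
    by (rule prod.reindex_bij_witness[of _ Suc "\<lambda>i. i - 1"]) auto
  finally show ?thesis .
qed

text \<open>Columns start with at least 1 and increase strictly, and the box above exists because
  the parts decrease. Entries at most \<open>m\<close> are thereby confined to the first
  \<open>m\<close> rows.\<close>

lemma ssyt_row_le_entry:
  assumes T: "T \<in> ssyt m lam" and lam: "sorted_wrt (\<ge>) lam"
    and ij: "(i, j) \<in> young_diagram lam"
  shows "i \<le> T (i, j)"
  using ij
proof (induction i)
  case (Suc i)
  show ?case
  proof (cases "i = 0")
    case True
    then show ?thesis using T Suc.prems by (auto simp: ssyt_def PiE_iff)
  next
    case False
    then have "lam ! i \<le> lam ! (i - 1)"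
      using Suc.prems lam by (auto simp: sorted_wrt_iff_nth_less young_diagram_def)
    then have "(i, j) \<in> young_diagram lam"
      using Suc.prems False by (auto simp: young_diagram_def)
    then have "i \<le> T (i, j)" "T (i, j) < T (Suc i, j)"
      using Suc T by (auto simp: ssyt_def)
    then show ?thesis by simp
  qed
qed simp

lemma down_closed_eq_atLeastAtMost_card:
  assumes "S \<subseteq> {1..q}" "\<And>j j'. j' \<in> S \<Longrightarrow> 1 \<le> j \<Longrightarrow> j < j' \<Longrightarrow> j \<in> S"
  shows "S = {1..card S :: nat}"
proof (cases "S = {}")
  case False
  have fin: "finite S" using assms(1) finite_subset by blast
  have "S = {1..Max S}"
  proof
    show "S \<subseteq> {1..Max S}" using assms(1) Max_ge[OF fin] by auto
    show "{1..Max S} \<subseteq> S"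
      using assms(2)[OF Max_in[OF fin False]] Max_in[OF fin False] by (auto simp: order_le_less)
  qed
  then show ?thesis by (metis card_atLeastAtMost diff_Suc_1)
qed simp

section \<open>Removing and restoring the largest letter of a tableau\<close>

text \<open>The shape that remains when the letter \<open>Suc m\<close> is deleted. Rows are counted
  from 0 here but from 1 in \<open>T\<close>; \<open>restrict\<close> makes the result an element of
  the extensional function space.\<close>

definition row_prefix :: "nat \<Rightarrow> nat list \<Rightarrow> (nat \<times> nat \<Rightarrow> nat) \<Rightarrow> nat \<Rightarrow> nat" where
  "row_prefix m lam T = (\<lambda>i\<in>{0..<m}. card {j \<in> {1..lam ! i}. T (Suc i, j) \<le> m})"

text \<open>The inverse construction: every box outside the inner shape \<open>g\<close> receives
  the letter \<open>Suc m\<close>.\<close>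

definition extend_tableau ::
    "nat \<Rightarrow> nat list \<Rightarrow> (nat \<Rightarrow> nat) \<Rightarrow> (nat \<times> nat \<Rightarrow> nat) \<Rightarrow> nat \<times> nat \<Rightarrow> nat" where
  "extend_tableau m lam g T = (\<lambda>c\<in>young_diagram lam.
     if c \<in> young_diagram (map g [0..<m]) then T c else Suc m)"

lemma mem_young_diagram_map:
  "(i, j) \<in> young_diagram (map g [0..<m]) \<longleftrightarrow> 1 \<le> i \<and> i \<le> m \<and> 1 \<le> j \<and> j \<le> g (i - 1)"
  by (auto simp: young_diagram_def)

context
  fixes m :: nat and lam :: "nat list"
  assumes len: "length lam = Suc m" and dec: "sorted_wrt (\<ge>) lam"
begin

text \<open>These inequalities say that \<open>lam\<close> is obtained from the inner shape by
  adding a horizontal strip, with at most one box in each column.\<close>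

abbreviation interlacing :: "(nat \<Rightarrow> nat) set" where
  "interlacing \<equiv> \<Pi>\<^sub>E i\<in>{0..<m}. {lam ! Suc i..lam ! i}"

lemma part_antimono: "i \<le> j \<Longrightarrow> j \<le> m \<Longrightarrow> lam ! j \<le> lam ! i"
  using dec len by (cases "i = j") (auto simp: sorted_wrt_iff_nth_less)

lemma mem_young_diagram: "(i, j) \<in> young_diagram lam \<longleftrightarrow> 1 \<le> i \<and> i \<le> Suc m \<and> 1 \<le> j \<and> j \<le> lam ! (i - 1)"
  using len by (auto simp: young_diagram_def)

lemma interlacing_bounds:
  assumes "g \<in> interlacing" "1 \<le> i" "i \<le> m"
  shows "lam ! i \<le> g (i - 1)" "g (i - 1) \<le> lam ! (i - 1)"
proof -
  have "g (i - 1) \<in> {lam ! Suc (i - 1)..lam ! (i - 1)}"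
    using assms by (intro PiE_mem[OF assms(1)]) auto
  then show "lam ! i \<le> g (i - 1)" "g (i - 1) \<le> lam ! (i - 1)" using assms by auto
qed

lemma interlacing_sub_diagram:
  assumes "g \<in> interlacing" "c \<in> young_diagram (map g [0..<m])"
  shows "c \<in> young_diagram lam"
proof (cases c)
  case (Pair i j)
  then have "1 \<le> i" "i \<le> m" "1 \<le> j" "j \<le> g (i - 1)"
    using assms(2) by (auto simp: mem_young_diagram_map)
  then show ?thesis
    using interlacing_bounds(2)[OF assms(1), of i] by (simp add: Pair mem_young_diagram)
qed

text \<open>Rows increase weakly, so the entries at most \<open>m\<close> form an initial segment of
  the row and are determined by their number.\<close>

lemma row_prefix_iff:
  assumes T: "T \<in> ssyt (Suc m) lam" and i: "1 \<le> i" "i \<le> m"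
  shows "1 \<le> j \<and> j \<le> row_prefix m lam T (i - 1)
    \<longleftrightarrow> (i, j) \<in> young_diagram lam \<and> T (i, j) \<le> m"
proof -
  let ?S = "{j \<in> {1..lam ! (i - 1)}. T (i, j) \<le> m}"
  have "?S = {1..card ?S}"
  proof (rule down_closed_eq_atLeastAtMost_card)
    fix j j' assume "j' \<in> ?S" "1 \<le> j" "j < j'"
    moreover from this have "T (i, j) \<le> T (i, j')"
      using T i by (auto simp: ssyt_def mem_young_diagram)
    ultimately show "j \<in> ?S" by auto
  qed auto
  moreover have "row_prefix m lam T (i - 1) = card ?S"
    using i by (simp add: row_prefix_def)
  ultimately have "j \<in> {1..row_prefix m lam T (i - 1)} \<longleftrightarrow> j \<in> ?S" by simp
  then show ?thesis using i by (auto simp: mem_young_diagram)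
qed

lemma mem_row_prefix_diagram:
  assumes T: "T \<in> ssyt (Suc m) lam"
  shows "c \<in> young_diagram (map (row_prefix m lam T) [0..<m])
    \<longleftrightarrow> c \<in> young_diagram lam \<and> T c \<le> m"
proof (cases c)
  case (Pair i j)
  show ?thesis
  proof (cases "1 \<le> i \<and> i \<le> m")
    case True
    then show ?thesis
      using row_prefix_iff[OF T, of i j] by (simp add: Pair mem_young_diagram_map)
  next
    case False
    have "i \<le> m" if "(i, j) \<in> young_diagram lam" "T (i, j) \<le> m"
      using ssyt_row_le_entry[OF T dec that(1)] that(2) by simp
    then show ?thesis using False by (auto simp: Pair mem_young_diagram_map mem_young_diagram)
  qed
qed

text \<open>For the lower bound, the last box of the next row has an entry at most
  \<open>Suc m\<close>; the box directly above it is smaller, so it belongs to the prefix.\<close>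

lemma row_prefix_interlacing:
  assumes T: "T \<in> ssyt (Suc m) lam"
  shows "row_prefix m lam T \<in> interlacing"
proof (rule PiE_I)
  fix i assume "i \<in> {0..<m}"
  then have i: "i < m" by simp
  have "row_prefix m lam T i \<le> card {1..lam ! i}"
    using i unfolding row_prefix_def by (simp del: card_atLeastAtMost, intro card_mono) auto
  moreover have "lam ! Suc i \<le> row_prefix m lam T i"
  proof (cases "lam ! Suc i = 0")
    case False
    then have in1: "(Suc (Suc i), lam ! Suc i) \<in> young_diagram lam"
      using i by (simp add: mem_young_diagram)
    have in2: "(Suc i, lam ! Suc i) \<in> young_diagram lam"
      using i False part_antimono[of i "Suc i"] by (simp add: mem_young_diagram)
    have "T (Suc i, lam ! Suc i) < T (Suc (Suc i), lam ! Suc i)"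
      using T in1 in2 by (auto simp: ssyt_def)
    moreover have "T (Suc (Suc i), lam ! Suc i) \<le> Suc m"
      using PiE_mem[OF ssyt_PiE[OF T] in1] by simp
    ultimately have "T (Suc i, lam ! Suc i) \<le> m" by simp
    then show ?thesis using row_prefix_iff[OF T, of "Suc i" "lam ! Suc i"] in2 i by simp
  qed simp
  ultimately show "row_prefix m lam T i \<in> {lam ! Suc i..lam ! i}" by simp
qed (simp add: row_prefix_def)

lemma restrict_tableau_ssyt:
  assumes T: "T \<in> ssyt (Suc m) lam"
  shows "restrict T (young_diagram (map (row_prefix m lam T) [0..<m]))
    \<in> ssyt m (map (row_prefix m lam T) [0..<m])"
proof -
  let ?Y = "young_diagram (map (row_prefix m lam T) [0..<m])"
  have Y: "c \<in> young_diagram lam" "T c \<le> m" if "c \<in> ?Y" for c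
    using that mem_row_prefix_diagram[OF T] by blast+
  have "restrict T ?Y \<in> ?Y \<rightarrow>\<^sub>E {1..m}"
    using Y PiE_mem[OF ssyt_PiE[OF T]] by (intro PiE_I) auto
  moreover have "restrict T ?Y (i, j) \<le> restrict T ?Y (i, j')"
    if "(i, j) \<in> ?Y \<and> (i, j') \<in> ?Y \<and> j < j'" for i j j'
    using that T Y(1) by (simp add: ssyt_def)
  moreover have "restrict T ?Y (i, j) < restrict T ?Y (i', j)"
    if "(i, j) \<in> ?Y \<and> (i', j) \<in> ?Y \<and> i < i'" for i i' j
    using that T Y(1) by (simp add: ssyt_def)
  ultimately show ?thesis unfolding ssyt_def by blast
qed

lemma extend_tableau_ssyt:
  assumes g: "g \<in> interlacing" and T: "T \<in> ssyt m (map g [0..<m])"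
  shows "extend_tableau m lam g T \<in> ssyt (Suc m) lam"
proof -
  let ?Y = "young_diagram (map g [0..<m])"
  have range: "1 \<le> T c" "T c \<le> m" if "c \<in> ?Y" for c
    using PiE_mem[OF ssyt_PiE[OF T] that] by simp_all
  have row: "T (i, j) \<le> T (i, j')" if "(i, j) \<in> ?Y" "(i, j') \<in> ?Y" "j < j'" for i j j'
    using T that by (auto simp: ssyt_def)
  have col: "T (i, j) < T (i', j)" if "(i, j) \<in> ?Y" "(i', j) \<in> ?Y" "i < i'" for i i' j
    using T that by (auto simp: ssyt_def)
  have left: "(i, j) \<in> ?Y" if "(i, j') \<in> ?Y" "j < j'" "(i, j) \<in> young_diagram lam" for i j j'
    using that by (auto simp: mem_young_diagram_map mem_young_diagram)
  \<comment> \<open>A box of \<open>lam\<close> with another box of \<open>lam\<close> below it lies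
    in the inner shape, by interlacing. So no column receives the letter \<open>Suc m\<close>
    twice.\<close>
  have above: "(i, j) \<in> ?Y"
    if "(i, j) \<in> young_diagram lam" "(i', j) \<in> young_diagram lam" "i < i'" for i i' j
  proof -
    have i: "1 \<le> i" "i \<le> m" and j: "1 \<le> j" "j \<le> lam ! (i' - 1)" "i' \<le> Suc m"
      using that by (auto simp: mem_young_diagram)
    have "lam ! (i' - 1) \<le> lam ! i"
      using that(3) j by (intro part_antimono) auto
    then have "j \<le> g (i - 1)" using interlacing_bounds(1)[OF g i] j by linarith
    then show ?thesis using i j by (simp add: mem_young_diagram_map)
  qed
  have "extend_tableau m lam g T (i, j) \<le> extend_tableau m lam g T (i, j')"
    if "(i, j) \<in> young_diagram lam" "(i, j') \<in> young_diagram lam" "j < j'" for i j j'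
    using that row[of i j j'] left[of i j' j] range(2)[of "(i, j)"]
    by (auto simp: extend_tableau_def)
  moreover have "extend_tableau m lam g T (i, j) < extend_tableau m lam g T (i', j)"
    if "(i, j) \<in> young_diagram lam" "(i', j) \<in> young_diagram lam" "i < i'" for i i' j
    using that above[of i j i'] col[of i j i'] range(2)[of "(i, j)"]
    by (auto simp: extend_tableau_def)
  moreover have "extend_tableau m lam g T \<in> young_diagram lam \<rightarrow>\<^sub>E {1..Suc m}"
    using range by (auto simp: extend_tableau_def le_SucI)
  ultimately show ?thesis unfolding ssyt_def by blast
qed

lemma extend_tableau_le_iff:
  assumes T: "T \<in> ssyt m (map g [0..<m])" and c: "c \<in> young_diagram lam"
  shows "extend_tableau m lam g T c \<le> m \<longleftrightarrow> c \<in> young_diagram (map g [0..<m])"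
  using c PiE_mem[OF ssyt_PiE[OF T], of c] by (simp add: extend_tableau_def)

lemma row_prefix_extend_tableau:
  assumes g: "g \<in> interlacing" and T: "T \<in> ssyt m (map g [0..<m])"
  shows "row_prefix m lam (extend_tableau m lam g T) = g"
proof
  fix i
  show "row_prefix m lam (extend_tableau m lam g T) i = g i"
  proof (cases "i < m")
    case True
    have "{j \<in> {1..lam ! i}. extend_tableau m lam g T (Suc i, j) \<le> m} = {1..g i}"
      using True interlacing_bounds(2)[OF g, of "Suc i"] extend_tableau_le_iff[OF T]
      by (auto simp: mem_young_diagram mem_young_diagram_map)
    then show ?thesis using True by (simp add: row_prefix_def)
  next
    case False
    then show ?thesis using PiE_arb[OF g, of i] by (simp add: row_prefix_def)
  qed
qed

text \<open>Tableaux are grouped by the shape of their entries at most \<open>m\<close>. The boxes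
  holding \<open>Suc m\<close> contribute the strip weight in the first \<open>m\<close> rows, and
  they fill the bottom row completely. The right-hand side has the form of
  \<open>alternant_branching\<close>, up to the factors
  \<open>\<pi>_j - \<pi>_(m+1)\<close>.\<close>

lemma loop_schur_branching:
  "loop_schur n (Suc m) r lam
    = (\<Sum>g\<in>interlacing.
         (\<Prod>i = 0..<m. \<Prod>t = Suc (g i)..lam ! i. x_var n (Suc m) (r + int (Suc i) - int t))
         * loop_schur n m r (map g [0..<m]))
      * (\<Prod>t = 1..lam ! m. x_var n (Suc m) (r + int (Suc m) - int t))"
proof -
  let ?x = "\<lambda>a i t. x_var n a (r + int i - int t)"
  let ?wt = "\<lambda>T Y. \<Prod>(i, j)\<in>young_diagram Y. ?x (T (i, j)) i j"
  let ?last = "\<Prod>t = 1..lam ! m. ?x (Suc m) (Suc m) t"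
  let ?strip = "\<lambda>g. \<Prod>i = 0..<m. \<Prod>t = Suc (g i)..lam ! i. ?x (Suc m) (Suc i) t"
  have weight: "?wt (extend_tableau m lam g T) lam = ?strip g * ?wt T (map g [0..<m]) * ?last"
    if g: "g \<in> interlacing" and T: "T \<in> ssyt m (map g [0..<m])" for g T
  proof -
    let ?E = "extend_tableau m lam g T"
    have row: "(\<Prod>j = 1..lam ! i. ?x (?E (Suc i, j)) (Suc i) j)
        = (\<Prod>t = Suc (g i)..lam ! i. ?x (Suc m) (Suc i) t) * (\<Prod>j = 1..g i. ?x (T (Suc i, j)) (Suc i) j)"
      if "i < m" for i
    proof -
      have gi: "g i \<le> lam ! i" using interlacing_bounds(2)[OF g, of "Suc i"] that by simp
      then have "{1..lam ! i} = {Suc (g i)..lam ! i} \<union> {1..g i}" by auto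
      then have "(\<Prod>j = 1..lam ! i. ?x (?E (Suc i, j)) (Suc i) j)
        = (\<Prod>j = Suc (g i)..lam ! i. ?x (?E (Suc i, j)) (Suc i) j) * (\<Prod>j = 1..g i. ?x (?E (Suc i, j)) (Suc i) j)"
        by (simp only:) (rule prod.union_disjoint, auto)
      moreover have "?E (Suc i, j) = Suc m" if "j \<in> {Suc (g i)..lam ! i}" for j
        using that \<open>i < m\<close> by (simp add: extend_tableau_def mem_young_diagram mem_young_diagram_map)
      moreover have "?E (Suc i, j) = T (Suc i, j)" if "j \<in> {1..g i}" for j
        using that gi \<open>i < m\<close> by (simp add: extend_tableau_def mem_young_diagram mem_young_diagram_map)
      ultimately show ?thesis by simp
    qed
    have bottom: "?E (Suc m, j) = Suc m" if "j \<in> {1..lam ! m}" for j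
      using that by (simp add: extend_tableau_def mem_young_diagram mem_young_diagram_map)
    have "?wt ?E lam = (\<Prod>i = 0..<m. \<Prod>j = 1..lam ! i. ?x (?E (Suc i, j)) (Suc i) j)
        * (\<Prod>j = 1..lam ! m. ?x (?E (Suc m, j)) (Suc m) j)"
      unfolding prod_young_diagram len by simp
    also have "(\<Prod>j = 1..lam ! m. ?x (?E (Suc m, j)) (Suc m) j) = ?last"
      by (simp add: bottom)
    also have "(\<Prod>i = 0..<m. \<Prod>j = 1..lam ! i. ?x (?E (Suc i, j)) (Suc i) j)
        = ?strip g * (\<Prod>i = 0..<m. \<Prod>j = 1..g i. ?x (T (Suc i, j)) (Suc i) j)"
      unfolding prod.distrib[symmetric] by (rule prod.cong) (simp_all only: row atLeastLessThan_iff)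
    also have "(\<Prod>i = 0..<m. \<Prod>j = 1..g i. ?x (T (Suc i, j)) (Suc i) j) = ?wt T (map g [0..<m])"
      unfolding prod_young_diagram by simp
    finally show ?thesis .
  qed
  have "(\<Sum>g\<in>interlacing. ?strip g * loop_schur n m r (map g [0..<m])) * ?last
    = (\<Sum>g\<in>interlacing. \<Sum>T\<in>ssyt m (map g [0..<m]). ?strip g * ?wt T (map g [0..<m]) * ?last)"
    by (simp add: loop_schur_def sum_distrib_left sum_distrib_right)
  also have "\<dots> = (\<Sum>(g, T)\<in>(SIGMA g:interlacing. ssyt m (map g [0..<m])).
      ?strip g * ?wt T (map g [0..<m]) * ?last)"
    by (rule sum.Sigma) (auto intro!: finite_PiE finite_ssyt)
  also have "\<dots> = (\<Sum>T\<in>ssyt (Suc m) lam. ?wt T lam)"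
  proof (rule sum.reindex_bij_witness[where j = "\<lambda>(g, T). extend_tableau m lam g T"
        and i = "\<lambda>T. (row_prefix m lam T,
          restrict T (young_diagram (map (row_prefix m lam T) [0..<m])))"], goal_cases)
    case (1 gT)
    then obtain g T where gT: "gT = (g, T)" "g \<in> interlacing" "T \<in> ssyt m (map g [0..<m])" by auto
    have "restrict (extend_tableau m lam g T) (young_diagram (map g [0..<m])) = T"
    proof
      fix c
      show "restrict (extend_tableau m lam g T) (young_diagram (map g [0..<m])) c = T c"
        using interlacing_sub_diagram[OF gT(2), of c] PiE_arb[OF ssyt_PiE[OF gT(3)], of c]
        by (cases "c \<in> young_diagram (map g [0..<m])") (simp_all add: extend_tableau_def)
    qed
    then show ?case by (simp add: gT row_prefix_extend_tableau)
  next
    case (2 gT)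
    then show ?case by (auto simp: extend_tableau_ssyt)
  next
    case (3 T)
    have "extend_tableau m lam (row_prefix m lam T)
        (restrict T (young_diagram (map (row_prefix m lam T) [0..<m]))) c = T c" for c
    proof (cases "c \<in> young_diagram lam")
      case True
      then have "T c \<le> Suc m" using PiE_mem[OF ssyt_PiE[OF 3], of c] by simp
      then show ?thesis using True by (simp add: extend_tableau_def mem_row_prefix_diagram[OF 3])
    next
      case False
      then show ?thesis using PiE_arb[OF ssyt_PiE[OF 3], of c] by (simp add: extend_tableau_def)
    qed
    then show ?case by (simp add: fun_eq_iff)
  next
    case (4 T)
    then show ?case by (simp add: row_prefix_interlacing restrict_tableau_ssyt)
  next
    case (5 gT)
    then show ?case by (auto simp: weight)
  qed
  finally show ?thesis by (simp add: loop_schur_def)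
qed

end

section \<open>The bialternant formula\<close>

text \<open>There is exactly one function with empty domain, and its weight is an empty product.
  This settles both the case of no alphabets and the denominator.\<close>

lemma loop_schur_empty_diagram:
  assumes "young_diagram lam = {}"
  shows "loop_schur n m r lam = 1"
proof -
  have "ssyt m lam = {\<lambda>_. undefined}"
    unfolding ssyt_def assms by auto
  then show ?thesis by (simp add: loop_schur_def assms)
qed

lemma alternant_cong:
  assumes "\<And>i. i < m \<Longrightarrow> l i = l' i"
  shows "alternant n m r l = alternant n m r l'"
  unfolding alternant_def using assms by (intro arg_cong[where f = det] cong_mat) auto

lemma prod_pairs_Suc:
  fixes f :: "nat \<Rightarrow> nat \<Rightarrow> 'a :: comm_monoid_mult"
  shows "(\<Prod>(i, j)\<in>{(i, j). 1 \<le> i \<and> i < j \<and> j \<le> Suc m}. f i j)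
    = (\<Prod>(i, j)\<in>{(i, j). 1 \<le> i \<and> i < j \<and> j \<le> m}. f i j) * (\<Prod>i = 0..<m. f (Suc i) (Suc m))"
proof -
  let ?P = "\<lambda>m. {(i :: nat, j). 1 \<le> i \<and> i < j \<and> j \<le> m}"
  have fin: "finite (?P m)"
    by (rule finite_subset[of _ "{1..m} \<times> {1..m}"]) auto
  have "?P (Suc m) = ?P m \<union> (\<lambda>i. (Suc i, Suc m)) ` {0..<m}"
  proof (intro equalityI subsetI)
    fix c assume "c \<in> ?P (Suc m)"
    then obtain i j where c: "c = (Suc i, j)" "Suc i < j" "j \<le> Suc m"
      by (cases c, cases "fst c") auto
    then show "c \<in> ?P m \<union> (\<lambda>i. (Suc i, Suc m)) ` {0..<m}"
      by (cases "j = Suc m") auto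
  qed auto
  then have "(\<Prod>(i, j)\<in>?P (Suc m). f i j)
    = (\<Prod>(i, j)\<in>?P m. f i j) * (\<Prod>(i, j)\<in>(\<lambda>i. (Suc i, Suc m)) ` {0..<m}. f i j)"
    by (simp only:) (rule prod.union_disjoint, use fin in auto)
  also have "(\<Prod>(i, j)\<in>(\<lambda>i. (Suc i, Suc m)) ` {0..<m}. f i j) = (\<Prod>i = 0..<m. f (Suc i) (Suc m))"
    by (subst prod.reindex) (auto simp: inj_on_def)
  finally show ?thesis .
qed

text \<open>Induction on the number of alphabets: the two branching rules have the same strip
  weights, and the additional factors of the determinant are the new factors of the product of
  differences.\<close>

lemma alternant_eq_loop_schur:
  assumes "n \<ge> 1" "length lam = m" "sorted_wrt (\<ge>) lam"
  shows "alternant n m r (\<lambda>i. lam ! i)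
    = (\<Prod>(i, j)\<in>{(i, j). 1 \<le> i \<and> i < j \<and> j \<le> m}. x_pi n i - x_pi n j) * loop_schur n m r lam"
  using assms(2,3)
proof (induction m arbitrary: lam)
  case 0
  have "{(i :: nat, j). 1 \<le> i \<and> i < j \<and> j \<le> (0 :: nat)} = {}" by auto
  moreover have "alternant n 0 r l = 1" for l by (simp add: alternant_def)
  moreover have "loop_schur n 0 r lam = 1"
    using 0 by (intro loop_schur_empty_diagram) (auto simp: young_diagram_def)
  ultimately show ?case by (simp only: prod.empty mult_1)
next
  case (Suc m)
  let ?V = "\<Prod>(i, j)\<in>{(i, j). 1 \<le> i \<and> i < j \<and> j \<le> m}. x_pi n i - x_pi n j"
  have IH: "alternant n m r g = ?V * loop_schur n m r (map g [0..<m])"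
    if g: "g \<in> interlacing m lam" for g
  proof -
    \<comment> \<open>An interlacing sequence is itself a partition, so the induction hypothesis
      applies to it: \<open>g j \<le> lam ! j \<le> lam ! Suc i \<le> g i\<close>.\<close>
    have "g j \<le> g i" if "i < j" "j < m" for i j
    proof -
      have "g j \<le> lam ! j" using interlacing_bounds(2)[OF Suc.prems g, of "Suc j"] that by simp
      also have "\<dots> \<le> lam ! Suc i" using part_antimono[OF Suc.prems, of "Suc i" j] that by simp
      also have "\<dots> \<le> g i" using interlacing_bounds(1)[OF Suc.prems g, of "Suc i"] that by simp
      finally show ?thesis .
    qed
    then have "sorted_wrt (\<ge>) (map g [0..<m])" by (simp add: sorted_wrt_iff_nth_less)
    moreover have "alternant n m r g = alternant n m r (\<lambda>i. map g [0..<m] ! i)"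
      by (rule alternant_cong) simp
    ultimately show ?thesis using Suc.IH[of "map g [0..<m]"] by simp
  qed
  have "lam ! Suc i \<le> lam ! i" if "i < m" for i
    using part_antimono[OF Suc.prems, of i "Suc i"] that by simp
  note branching = alternant_branching[where l = "\<lambda>i. lam ! i", OF assms(1) this]
  have "(\<Sum>g\<in>interlacing m lam.
      (\<Prod>i = 0..<m. \<Prod>t = Suc (g i)..lam ! i. x_var n (Suc m) (r + int (Suc i) - int t))
      * alternant n m r g)
    = ?V * (\<Sum>g\<in>interlacing m lam.
      (\<Prod>i = 0..<m. \<Prod>t = Suc (g i)..lam ! i. x_var n (Suc m) (r + int (Suc i) - int t))
      * loop_schur n m r (map g [0..<m]))"
    unfolding sum_distrib_left by (intro sum.cong refl) (simp only: IH mult_ac)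
  then show ?case
    by (simp only: branching loop_schur_branching[OF Suc.prems] prod_pairs_Suc mult_ac)
qed

lemma b_det_add_staircase:
  assumes "length lam = m"
  shows "b_det n m r (map2 (+) lam (staircase m)) = alternant n m r (\<lambda>i. lam ! i)"
  unfolding b_det_def B_mat_def alternant_def
  by (intro arg_cong[where f = det] cong_mat)
    (use assms in \<open>auto simp: B_entry_eq_column_entry staircase_def simp del: upt_Suc\<close>)

theorem theorem3p3:
  fixes m n :: nat and r :: int and lam :: "nat list"
  assumes "m \<ge> 1" and "n \<ge> 1"
    and "length lam = m" and "sorted_wrt (\<ge>) lam"
  shows "b_det n m r (staircase m) \<noteq> 0 \<and>
    (\<Prod>(i, j)\<in>{(i, j). 1 \<le> i \<and> i < j \<and> j \<le> m}. x_pi n i - x_pi n j) \<noteq> 0 \<and>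
    loop_schur n m r lam =
      b_det n m r (map2 (+) lam (staircase m)) / b_det n m r (staircase m) \<and>
    b_det n m r (map2 (+) lam (staircase m)) / b_det n m r (staircase m) =
      b_det n m r (map2 (+) lam (staircase m)) /
        (\<Prod>(i, j)\<in>{(i, j). 1 \<le> i \<and> i < j \<and> j \<le> m}. x_pi n i - x_pi n j)"
proof -
  let ?P = "{(i, j). 1 \<le> i \<and> i < j \<and> j \<le> m}"
  let ?V = "\<Prod>(i, j)\<in>?P. x_pi n i - x_pi n j"
  have "finite ?P"
    by (rule finite_subset[of _ "{1..m} \<times> {1..m}"]) auto
  then have V: "?V \<noteq> 0"
    using x_pi_inject[OF assms(2)] by fastforce
  have lam: "b_det n m r (map2 (+) lam (staircase m)) = ?V * loop_schur n m r lam"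
    using alternant_eq_loop_schur[OF assms(2-4)] b_det_add_staircase[OF assms(3)] by simp
  \<comment> \<open>The denominator is the numerator for the zero partition, whose loop Schur
    function is 1.\<close>
  have "map2 (+) (replicate m 0) (staircase m) = staircase m"
    by (rule nth_equalityI) (auto simp: staircase_def simp del: upt_Suc)
  then have "b_det n m r (staircase m) = alternant n m r (\<lambda>i. replicate m 0 ! i)"
    using b_det_add_staircase[of "replicate m 0" m n r] by simp
  also have "\<dots> = ?V * loop_schur n m r (replicate m 0)"
    by (rule alternant_eq_loop_schur[OF assms(2)]) (auto simp: sorted_wrt_iff_nth_less)
  also have "loop_schur n m r (replicate m 0) = 1"
    by (rule loop_schur_empty_diagram) (auto simp: young_diagram_def)
  finally have "b_det n m r (staircase m) = ?V" by simp
  then show ?thesis using V lam by simp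
qed

end
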